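(* If a language $L\subseteq A^*$ belongs to $\mathcal B_1$, then $L$ satisfies the ultrafilter equations in the families $\mathcal E_{ab=ba}$, $\mathcal E_{aab=abb}$ and $\mathcal E_{a=a.a}$ for every $a,b\in A$.
   Context: $A$ is a finite alphabet. For $a\in A$, $c_a(w):=\{i<|w|: w_i=a\}$; $\mathcal B_1$ is the Boolean subalgebra of $\mathcal P(A^* )$ generated by the languages $\{w: c_a(w)\cap Q\neq\emptyset\}$, $a\in A$, $Q\subseteq\mathbb N$. $\beta(S)$ is the set of ultrafilters on $S$, $\beta f(\nu):=\{P: f^{-1}(P)\in\nu\}$; $L$ satisfies $\gamma_1\leftrightarrow\gamma_2$ iff ($L\in\gamma_1\iff L\in\gamma_2$). $A^*\otimes\mathbb N^n:=\{(w,j_1,\dots,j_n): j_m<|w|\}$. For $p_1,\dots,p_n:D\to\mathbb N$, $u,v:D\to A^*$ on $D=A^*\otimes\mathbb N^n$, $\mathcal E^{p_1,\dots,p_n}_{u=v}$ is the family of equations $\beta u(\nu)\leftrightarrow\beta v(\nu)$ for $\nu\in\beta(D)$ with $\beta p_1(\nu)=\dots=\beta p_n(\nu)$. $w((j_1,\dots,j_m)\to(b_1,\dots,b_m))$ replaces the letter at $j_r$ by $b_r$. $f_{a,b}(w,j_1,j_2):=w((j_1,j_2)\to(a,b))$ if $j_1\neq j_2$, else $w$; $f_{a,a,b}(w,j_1,j_2,j_3):=w((j_1,j_2,j_3)\to(a,a,b))$ if pairwise distinct, else $w$ (similarly $f_{a,b,b}$); $f_a(w,i):=w(i\to a)$,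 $(f_a.a)(w,i):=w(i\to a)\,a$. $\mathcal E_{ab=ba}:=\mathcal E^{\pi_1,\pi_2}_{f_{a,b}=f_{b,a}}$, $\mathcal E_{aab=abb}:=\mathcal E^{\pi_1,\pi_2,\pi_3}_{f_{a,a,b}=f_{a,b,b}}$, $\mathcal E_{a=a.a}:=\mathcal E^{\pi,|\cdot|}_{f_a=f_a.a}$, where $\pi_r$ are coordinate projections, $\pi(w,i)=i$, $|\cdot|(w,i)=|w|$. *)

theory Defs
  imports "HOL-Analysis.Sigma_Algebra"
begin

definition positions :: "'a \<Rightarrow> 'a list \<Rightarrow> nat set" where
  "positions a w = {i. i < length w \<and> w ! i = a}"

definition letter_in :: "'a set \<Rightarrow> 'a \<Rightarrow> nat set \<Rightarrow> 'a list set" where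
  "letter_in A a Q = {w \<in> lists A. positions a w \<inter> Q \<noteq> {}}"

text \<open>
  The locale predicate \<open>algebra \<Omega> M\<close> says that \<open>M\<close> is a Boolean subalgebra of the power set of
  \<open>\<Omega>\<close>; its hull is the intersection of all such subalgebras containing the generators.
\<close>

definition B1 :: "'a set \<Rightarrow> 'a list set set" where
  "B1 A = algebra (lists A) hull {letter_in A a Q | a Q. a \<in> A}"

definition ultrafilters_on :: "'b set \<Rightarrow> 'b set set set" where
  "ultrafilters_on S = {\<nu>. \<nu> \<subseteq> Pow S \<and> S \<in> \<nu> \<and> {} \<notin> \<nu> \<and>
     (\<forall>P\<in>\<nu>. \<forall>Q\<in>\<nu>. P \<inter> Q \<in> \<nu>) \<and>
     (\<forall>P\<in>\<nu>. \<forall>Q. P \<subseteq> Q \<and> Q \<subseteq> S \<longrightarrow> Q \<in> \<nu>) \<and>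
     (\<forall>P. P \<subseteq> S \<longrightarrow> P \<in> \<nu> \<or> S - P \<in> \<nu>)}"

text \<open>The extension of a map \<open>f\<close> from \<open>S\<close> to \<open>T\<close> to ultrafilters.\<close>

definition beta_map :: "'b set \<Rightarrow> 'c set \<Rightarrow> ('b \<Rightarrow> 'c) \<Rightarrow> 'b set set \<Rightarrow> 'c set set" where
  "beta_map S T f \<nu> = {P. P \<subseteq> T \<and> f -` P \<inter> S \<in> \<nu>}"

text \<open>An ultrafilter equation between \<open>\<gamma>\<close> and \<open>\<delta>\<close> is represented by the pair \<open>(\<gamma>, \<delta>)\<close>.\<close>

definition satisfies :: "'b set \<Rightarrow> 'b set set \<times> 'b set set \<Rightarrow> bool" where
  "satisfies L e \<longleftrightarrow> (L \<in> fst e \<longleftrightarrow> L \<in> snd e)"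

text \<open>
  A word with \<open>n\<close> marked positions \<open>(w, j\<^sub>1, \<dots>, j\<^sub>n)\<close> is encoded as the pair of \<open>w\<close> and the
  list \<open>[j\<^sub>1, \<dots>, j\<^sub>n]\<close>, so the \<open>r\<close>-th position is the list entry with index \<open>r - 1\<close>.
\<close>

type_synonym 'a marked = "'a list \<times> nat list"

definition marked_words :: "'a set \<Rightarrow> nat \<Rightarrow> 'a marked set" where
  "marked_words A n = {(w, js). w \<in> lists A \<and> length js = n \<and> (\<forall>j \<in> set js. j < length w)}"

text \<open>
  The number of functions in \<open>ps\<close> need not be the number \<open>n\<close> of marked positions: the family
  \<open>E_a_aa\<close> below uses two functions on words with one marked position.
\<close>

definition equations ::
    "'a set \<Rightarrow> nat \<Rightarrow> ('a marked \<Rightarrow> nat) list \<Rightarrow> ('a marked \<Rightarrow> 'a list) \<Rightarrow> ('a marked \<Rightarrow> 'a list)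
      \<Rightarrow> ('a list set set \<times> 'a list set set) set" where
  "equations A n ps u v =
     {(beta_map (marked_words A n) (lists A) u \<nu>, beta_map (marked_words A n) (lists A) v \<nu>) | \<nu>.
        \<nu> \<in> ultrafilters_on (marked_words A n) \<and>
        (\<forall>p \<in> set ps. \<forall>q \<in> set ps.
           beta_map (marked_words A n) UNIV p \<nu> = beta_map (marked_words A n) UNIV q \<nu>)}"

definition replace_letters :: "'a list \<Rightarrow> nat list \<Rightarrow> 'a list \<Rightarrow> 'a list" where
  "replace_letters w js bs = fold (\<lambda>(j, b) x. x[j := b]) (zip js bs) w"

text \<open>
  \<open>f_subst [b\<^sub>1, \<dots>, b\<^sub>n]\<close> is the function written \<open>f\<close> with subscripts \<open>b\<^sub>1, \<dots>, b\<^sub>n\<close>; for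
  \<open>n = 1\<close> the distinctness condition is vacuous.
\<close>

definition f_subst :: "'a list \<Rightarrow> 'a marked \<Rightarrow> 'a list" where
  "f_subst bs = (\<lambda>(w, js). if distinct js then replace_letters w js bs else w)"

definition coord :: "nat \<Rightarrow> 'a marked \<Rightarrow> nat" where
  "coord k = (\<lambda>(w, js). js ! k)"

definition word_length :: "'a marked \<Rightarrow> nat" where
  "word_length = (\<lambda>(w, js). length w)"

definition E_ab_ba :: "'a set \<Rightarrow> 'a \<Rightarrow> 'a \<Rightarrow> ('a list set set \<times> 'a list set set) set" where
  "E_ab_ba A a b = equations A 2 [coord 0, coord 1] (f_subst [a, b]) (f_subst [b, a])"

definition E_aab_abb :: "'a set \<Rightarrow> 'a \<Rightarrow> 'a \<Rightarrow> ('a list set set \<times> 'a list set set) set" where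
  "E_aab_abb A a b =
     equations A 3 [coord 0, coord 1, coord 2] (f_subst [a, a, b]) (f_subst [a, b, b])"

definition E_a_aa :: "'a set \<Rightarrow> 'a \<Rightarrow> ('a list set set \<times> 'a list set set) set" where
  "E_a_aa A a =
     equations A 1 [coord 0, word_length] (f_subst [a]) (\<lambda>x. f_subst [a] x @ [a])"

end

theory Submission
  imports Defs
begin

text \<open>
  If the projections \<open>p\<^sub>1, \<dots>, p\<^sub>n\<close> have the same image under \<open>\<nu>\<close>, then for each single set \<open>Q\<close>
  of positions, \<open>\<nu>\<close>-almost every point has either all or none of the values \<open>p\<^sub>r\<close> in \<open>Q\<close>. At such
  a point the two substitutions put the same set of letters into \<open>Q\<close>, hence they agree on the
  generators of \<open>\<B>\<^sub>1\<close>. The languages on which two maps agree \<open>\<nu>\<close>-almost everywhere form a Boolean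
  algebra, so the agreement extends to \<open>\<B>\<^sub>1\<close>.
\<close>

lemma ultrafilters_onD:
  assumes "\<nu> \<in> ultrafilters_on S"
  shows ultrafilter_space: "S \<in> \<nu>"
    and ultrafilter_Int: "P \<in> \<nu> \<Longrightarrow> Q \<in> \<nu> \<Longrightarrow> P \<inter> Q \<in> \<nu>"
    and ultrafilter_mono: "P \<in> \<nu> \<Longrightarrow> P \<subseteq> Q \<Longrightarrow> Q \<subseteq> S \<Longrightarrow> Q \<in> \<nu>"
    and ultrafilter_compl: "P \<subseteq> S \<Longrightarrow> P \<notin> \<nu> \<Longrightarrow> S - P \<in> \<nu>"
  using assms unfolding ultrafilters_on_def by blast+

text \<open>Lets the pairwise conditions on the finitely many maps in \<open>ps\<close> hold
  simultaneously almost everywhere.\<close>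

lemma ultrafilter_finite_ball:
  assumes \<nu>: "\<nu> \<in> ultrafilters_on S" and "finite I"
    and "\<And>i. i \<in> I \<Longrightarrow> {x \<in> S. R i x} \<in> \<nu>"
  shows "{x \<in> S. \<forall>i\<in>I. R i x} \<in> \<nu>"
  using assms(2,3)
proof (induction I rule: finite_induct)
  case empty
  then show ?case using ultrafilter_space[OF \<nu>] by simp
next
  case (insert i I)
  have "{x \<in> S. \<forall>k\<in>insert i I. R k x} = {x \<in> S. R i x} \<inter> {x \<in> S. \<forall>k\<in>I. R k x}"
    by auto
  then show ?case using insert ultrafilter_Int[OF \<nu>] by simp
qed

text \<open>The direction from right to left needs maximality: if neither set is in \<nu>, both
  complements are, and on their intersection both sides are false. The lemma serves twice, to turn
  equal images under \<nu> into agreement almost everywhere and to turn agreement back into an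
  ultrafilter equation.\<close>

lemma ultrafilter_iff:
  assumes \<nu>: "\<nu> \<in> ultrafilters_on S"
  shows "{x \<in> S. P x \<longleftrightarrow> Q x} \<in> \<nu> \<longleftrightarrow> ({x \<in> S. P x} \<in> \<nu> \<longleftrightarrow> {x \<in> S. Q x} \<in> \<nu>)"
    (is "?E \<in> \<nu> \<longleftrightarrow> (?P \<in> \<nu> \<longleftrightarrow> ?Q \<in> \<nu>)")
proof
  assume E: "?E \<in> \<nu>"
  have "?Q \<in> \<nu>" if "?P \<in> \<nu>"
    by (rule ultrafilter_mono[OF \<nu> ultrafilter_Int[OF \<nu> E that]]) auto
  moreover have "?P \<in> \<nu>" if "?Q \<in> \<nu>"
    by (rule ultrafilter_mono[OF \<nu> ultrafilter_Int[OF \<nu> E that]]) auto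
  ultimately show "?P \<in> \<nu> \<longleftrightarrow> ?Q \<in> \<nu>" by blast
next
  assume eq: "?P \<in> \<nu> \<longleftrightarrow> ?Q \<in> \<nu>"
  show "?E \<in> \<nu>"
  proof (cases "?P \<in> \<nu>")
    case True
    then have "?P \<inter> ?Q \<in> \<nu>" using eq ultrafilter_Int[OF \<nu>] by blast
    then show ?thesis by (rule ultrafilter_mono[OF \<nu>]) auto
  next
    case False
    then have "(S - ?P) \<inter> (S - ?Q) \<in> \<nu>"
      using eq by (intro ultrafilter_Int[OF \<nu>] ultrafilter_compl[OF \<nu>]) auto
    then show ?thesis by (rule ultrafilter_mono[OF \<nu>]) auto
  qed
qed

lemma mem_beta_map_iff:
  "P \<in> beta_map S T f \<nu> \<longleftrightarrow> P \<subseteq> T \<and> {x \<in> S. f x \<in> P} \<in> \<nu>"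
proof -
  have "f -` P \<inter> S = {x \<in> S. f x \<in> P}" by auto
  then show ?thesis by (simp add: beta_map_def)
qed

text \<open>Complementing L leaves the agreement set unchanged, since u and v map S into \<Omega>.
  Agreement on K \<inter> L holds wherever u and v agree on both K and L.\<close>

lemma algebra_agreement:
  assumes \<nu>: "\<nu> \<in> ultrafilters_on S"
    and u: "\<And>x. x \<in> S \<Longrightarrow> u x \<in> \<Omega>" and v: "\<And>x. x \<in> S \<Longrightarrow> v x \<in> \<Omega>"
  shows "algebra \<Omega> {L. L \<subseteq> \<Omega> \<and> {x \<in> S. u x \<in> L \<longleftrightarrow> v x \<in> L} \<in> \<nu>}"
  unfolding algebra_iff_Int
proof (intro conjI ballI)
  fix L assume L: "L \<in> {L. L \<subseteq> \<Omega> \<and> {x \<in> S. u x \<in> L \<longleftrightarrow> v x \<in> L} \<in> \<nu>}"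
  have "{x \<in> S. u x \<in> \<Omega> - L \<longleftrightarrow> v x \<in> \<Omega> - L} = {x \<in> S. u x \<in> L \<longleftrightarrow> v x \<in> L}"
    using u v by auto
  then show "\<Omega> - L \<in> {L. L \<subseteq> \<Omega> \<and> {x \<in> S. u x \<in> L \<longleftrightarrow> v x \<in> L} \<in> \<nu>}"
    using L by auto
next
  fix K L
  assume K: "K \<in> {L. L \<subseteq> \<Omega> \<and> {x \<in> S. u x \<in> L \<longleftrightarrow> v x \<in> L} \<in> \<nu>}"
    and L: "L \<in> {L. L \<subseteq> \<Omega> \<and> {x \<in> S. u x \<in> L \<longleftrightarrow> v x \<in> L} \<in> \<nu>}"
  have "{x \<in> S. u x \<in> K \<longleftrightarrow> v x \<in> K} \<inter> {x \<in> S. u x \<in> L \<longleftrightarrow> v x \<in> L} \<in> \<nu>"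
    using K L ultrafilter_Int[OF \<nu>] by blast
  then have "{x \<in> S. u x \<in> K \<inter> L \<longleftrightarrow> v x \<in> K \<inter> L} \<in> \<nu>"
    by (rule ultrafilter_mono[OF \<nu>]) auto
  then show "K \<inter> L \<in> {L. L \<subseteq> \<Omega> \<and> {x \<in> S. u x \<in> L \<longleftrightarrow> v x \<in> L} \<in> \<nu>}"
    using K by auto
qed (use ultrafilter_space[OF \<nu>] in auto)

text \<open>Removes the ultrafilter from the problem: what remains for each family is the condition
  \<open>agree\<close>, to be checked at one point x and for one set Q.\<close>

lemma B1_satisfies_equations:
  fixes A :: "'a set" and n :: nat
  defines "D \<equiv> marked_words A n"
  assumes L: "L \<in> B1 A" and e: "e \<in> equations A n ps u v"
    and u: "\<And>x. x \<in> D \<Longrightarrow> u x \<in> lists A" and v: "\<And>x. x \<in> D \<Longrightarrow> v x \<in> lists A"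
    and agree: "\<And>x c Q. \<lbrakk>x \<in> D; \<And>p q. \<lbrakk>p \<in> set ps; q \<in> set ps\<rbrakk> \<Longrightarrow> p x \<in> Q \<longleftrightarrow> q x \<in> Q\<rbrakk> \<Longrightarrow>
      positions c (u x) \<inter> Q = {} \<longleftrightarrow> positions c (v x) \<inter> Q = {}"
  shows "satisfies L e"
proof -
  from e obtain \<nu> where e_eq: "e = (beta_map D (lists A) u \<nu>, beta_map D (lists A) v \<nu>)"
    and \<nu>: "\<nu> \<in> ultrafilters_on D"
    and ps: "\<And>p q. \<lbrakk>p \<in> set ps; q \<in> set ps\<rbrakk> \<Longrightarrow> beta_map D UNIV p \<nu> = beta_map D UNIV q \<nu>"
    unfolding equations_def D_def by blast
  define M where "M = {L. L \<subseteq> lists A \<and> {x \<in> D. u x \<in> L \<longleftrightarrow> v x \<in> L} \<in> \<nu>}"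
  have gen: "letter_in A c Q \<in> M" for c Q
  proof -
    \<comment> \<open>The images of \<nu> under p and q coincide, so Q belongs to both or to
      neither.\<close>
    have "{x \<in> D. p x \<in> Q \<longleftrightarrow> q x \<in> Q} \<in> \<nu>" if "p \<in> set ps" "q \<in> set ps" for p q
      using ps[OF that] mem_beta_map_iff[of Q D UNIV _ \<nu>] ultrafilter_iff[OF \<nu>] by auto
    then have "{x \<in> D. \<forall>p\<in>set ps. \<forall>q\<in>set ps. p x \<in> Q \<longleftrightarrow> q x \<in> Q} \<in> \<nu>"
      by (intro ultrafilter_finite_ball[OF \<nu>]) auto
    then have "{x \<in> D. u x \<in> letter_in A c Q \<longleftrightarrow> v x \<in> letter_in A c Q} \<in> \<nu>"
    proof (rule ultrafilter_mono[OF \<nu>])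
      show "{x \<in> D. \<forall>p\<in>set ps. \<forall>q\<in>set ps. p x \<in> Q \<longleftrightarrow> q x \<in> Q}
          \<subseteq> {x \<in> D. u x \<in> letter_in A c Q \<longleftrightarrow> v x \<in> letter_in A c Q}"
      proof
        fix x assume "x \<in> {x \<in> D. \<forall>p\<in>set ps. \<forall>q\<in>set ps. p x \<in> Q \<longleftrightarrow> q x \<in> Q}"
        then have "x \<in> D" and "positions c (u x) \<inter> Q = {} \<longleftrightarrow> positions c (v x) \<inter> Q = {}"
          using agree[of x Q c] by blast+
        then show "x \<in> {x \<in> D. u x \<in> letter_in A c Q \<longleftrightarrow> v x \<in> letter_in A c Q}"
          using u v by (simp add: letter_in_def)
      qed
    qed blast
    then show ?thesis by (auto simp: M_def letter_in_def)
  qed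
  have "algebra (lists A) M"
    unfolding M_def using \<nu> u v by (rule algebra_agreement)
  \<comment> \<open>\<open>B1 A\<close> is the least algebra containing the generators, so no
    induction over Boolean combinations is required.\<close>
  then have "B1 A \<subseteq> M"
    unfolding B1_def using gen by (intro hull_minimal) auto
  with L have "L \<in> M" by blast
  then show ?thesis
    by (simp add: M_def e_eq satisfies_def mem_beta_map_iff ultrafilter_iff[OF \<nu>])
qed

lemma set_replace_letters_subset: "set (replace_letters w js bs) \<subseteq> set w \<union> set bs"
proof (induction js arbitrary: w bs)
  case (Cons j js)
  show ?case
  proof (cases bs)
    case (Cons b bs')
    have "set (replace_letters w (j # js) bs) \<subseteq> set (w[j := b]) \<union> set bs'"
      using Cons.IH[of "w[j := b]" bs'] Cons by (simp add: replace_letters_def)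
    then show ?thesis
      using Cons set_update_subset_insert[of w j b] by auto
  qed (simp add: replace_letters_def)
qed (simp add: replace_letters_def)

lemma set_f_subst_subset:
  assumes "x \<in> marked_words A n" and "set bs \<subseteq> A"
  shows "set (f_subst bs x) \<subseteq> A"
  using assms set_replace_letters_subset[of "fst x" "snd x" bs]
  by (auto simp: f_subst_def marked_words_def split: if_splits)

text \<open>The old letter at j is overwritten, so the original word only matters on Q - {j}. As a
  rewrite rule this peels off nested updates one at a time, shrinking Q at each step.\<close>

lemma positions_list_update_Int_empty_iff:
  assumes "j < length w"
  shows "positions c (w[j := b]) \<inter> Q = {} \<longleftrightarrow>
    (j \<in> Q \<longrightarrow> b \<noteq> c) \<and> positions c w \<inter> (Q - {j}) = {}"
  using assms by (auto simp: positions_def nth_list_update)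

lemma positions_append_singleton:
  "positions c (w @ [b]) = positions c w \<union> (if b = c then {length w} else {})"
  by (auto simp: positions_def nth_append)

text \<open>Let the positions be distinct; otherwise both sides are w. If both lie in Q, each word
  places a and b in Q; if neither does, the updates are invisible to Q. Elsewhere the words
  coincide.\<close>

lemma positions_f_subst_ab_ba:
  assumes "x \<in> marked_words A 2" and "coord 0 x \<in> Q \<longleftrightarrow> coord 1 x \<in> Q"
  shows "positions c (f_subst [a, b] x) \<inter> Q = {} \<longleftrightarrow> positions c (f_subst [b, a] x) \<inter> Q = {}"
proof -
  obtain w i j where "x = (w, [i, j])" "i < length w" "j < length w"
    using assms(1) by (auto simp: marked_words_def numeral_2_eq_2 length_Suc_conv)
  then show ?thesis
    using assms(2)
    by (simp add: f_subst_def replace_letters_def coord_def positions_list_update_Int_empty_iff)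
      blast
qed

text \<open>Only the occurrence of a letter in Q counts, not its multiplicity: when all three
  positions lie in Q, both words contribute exactly the letters a and b there.\<close>

lemma positions_f_subst_aab_abb:
  assumes "x \<in> marked_words A 3"
    and "coord 0 x \<in> Q \<longleftrightarrow> coord 1 x \<in> Q" and "coord 0 x \<in> Q \<longleftrightarrow> coord 2 x \<in> Q"
  shows "positions c (f_subst [a, a, b] x) \<inter> Q = {} \<longleftrightarrow>
    positions c (f_subst [a, b, b] x) \<inter> Q = {}"
proof -
  obtain w i j k where "x = (w, [i, j, k])" "i < length w" "j < length w" "k < length w"
    using assms(1) by (auto simp: marked_words_def numeral_3_eq_3 length_Suc_conv)
  then show ?thesis
    using assms(2,3)
    by (simp add: f_subst_def replace_letters_def coord_def positions_list_update_Int_empty_iff)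
qed

text \<open>Replacement preserves length, so the appended a sits at position
  \<open>word_length x\<close>. If that position is in Q, so is the marked one, which already
  carries an a.\<close>

lemma positions_f_subst_a_aa:
  assumes "x \<in> marked_words A 1" and "coord 0 x \<in> Q \<longleftrightarrow> word_length x \<in> Q"
  shows "positions c (f_subst [a] x) \<inter> Q = {} \<longleftrightarrow> positions c (f_subst [a] x @ [a]) \<inter> Q = {}"
proof -
  obtain w i where "x = (w, [i])" "i < length w"
    using assms(1) by (auto simp: marked_words_def length_Suc_conv)
  then show ?thesis
    using assms(2)
    by (auto simp: f_subst_def replace_letters_def coord_def word_length_def Int_Un_distrib2
        positions_append_singleton positions_list_update_Int_empty_iff)
qed

theorem mainTheorem14:
  fixes A :: "'a set" and L :: "'a list set"
  assumes "finite A"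
    and "L \<subseteq> lists A"
    and "L \<in> B1 A"
  shows "\<forall>a\<in>A. \<forall>b\<in>A.
           (\<forall>e \<in> E_ab_ba A a b. satisfies L e) \<and>
           (\<forall>e \<in> E_aab_abb A a b. satisfies L e) \<and>
           (\<forall>e \<in> E_a_aa A a. satisfies L e)"
proof (intro ballI conjI)
  fix a b e assume ab: "a \<in> A" "b \<in> A"
  {
    assume "e \<in> E_ab_ba A a b"
    with assms(3) show "satisfies L e"
      unfolding E_ab_ba_def
    proof (rule B1_satisfies_equations)
      fix x :: "'a marked" and c :: 'a and Q
      assume "x \<in> marked_words A 2"
        and "\<And>p q. \<lbrakk>p \<in> set [coord 0, coord 1]; q \<in> set [coord 0, coord 1]\<rbrakk>
          \<Longrightarrow> p x \<in> Q \<longleftrightarrow> q x \<in> Q"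
      then show "positions c (f_subst [a, b] x) \<inter> Q = {} \<longleftrightarrow>
          positions c (f_subst [b, a] x) \<inter> Q = {}"
        by (intro positions_f_subst_ab_ba) auto
    \<comment> \<open>The goals left over say that both maps take values in \<open>lists A\<close>;
      here a, b \<in> A is used.\<close>
    qed (use ab in \<open>simp_all add: lists_eq_set set_f_subst_subset\<close>)
  next
    assume "e \<in> E_aab_abb A a b"
    with assms(3) show "satisfies L e"
      unfolding E_aab_abb_def
    proof (rule B1_satisfies_equations)
      fix x :: "'a marked" and c :: 'a and Q
      assume "x \<in> marked_words A 3"
        and "\<And>p q. \<lbrakk>p \<in> set [coord 0, coord 1, coord 2]; q \<in> set [coord 0, coord 1, coord 2]\<rbrakk>
          \<Longrightarrow> p x \<in> Q \<longleftrightarrow> q x \<in> Q"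
      then show "positions c (f_subst [a, a, b] x) \<inter> Q = {} \<longleftrightarrow>
          positions c (f_subst [a, b, b] x) \<inter> Q = {}"
        by (intro positions_f_subst_aab_abb) auto
    qed (use ab in \<open>simp_all add: lists_eq_set set_f_subst_subset\<close>)
  next
    assume "e \<in> E_a_aa A a"
    with assms(3) show "satisfies L e"
      unfolding E_a_aa_def
    proof (rule B1_satisfies_equations)
      fix x :: "'a marked" and c :: 'a and Q
      assume "x \<in> marked_words A 1"
        and "\<And>p q. \<lbrakk>p \<in> set [coord 0, word_length]; q \<in> set [coord 0, word_length]\<rbrakk>
          \<Longrightarrow> p x \<in> Q \<longleftrightarrow> q x \<in> Q"
      then show "positions c (f_subst [a] x) \<inter> Q = {} \<longleftrightarrow>
          positions c (f_subst [a] x @ [a]) \<inter> Q = {}"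
        by (intro positions_f_subst_a_aa) auto
    qed (use ab in \<open>simp_all add: lists_eq_set set_f_subst_subset\<close>)
  }
qed

end
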